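(* Let $k\geq 2$ be an integer. For $n\geq 0$ let $f_k(n)$ denote the number of words over $[k]=\{1,\ldots,k\}$ of length $n$ with no repeated letter equal to the previous repeated letter (with $f_k(0)=1$), and let $F_k(x)=\sum_{n\geq 0}f_k(n)x^n$. Then \[F_k(x)=-\frac{(k-2)x^3+2(k-2)x^2+(k-3)x-1}{2(k-1)^2x^3+(k-1)(k-4)x^2+(3-2k)x+1}.\]
   Context: A word over $[k]$ of length $n$ is an element $w_1\cdots w_n$ of $[k]^n$. A repeated letter occurs at position $j$ (where $2\leq j\leq n$) if $w_j=w_{j-1}$; the repeated letter is then $w_j$. A word has no repeated letter equal to the previous repeated letter if, whenever $j<j'$ are two consecutive positions at which repeated letters occur (that is, $w_j=w_{j-1}$, $w_{j'}=w_{j'-1}$, and there is no $l$ with $j<l<j'$ and $w_l=w_{l-1}$), one has $w_j\neq w_{j'}$. For example, words containing $aaa$ as consecutive letters are not allowed, and neither is $aabaa$ for $a\ne b$. *)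

theory Defs
  imports "HOL-Computational_Algebra.Formal_Power_Series"
begin

text \<open>Words are lists, so positions are counted from 0: the letter $w_j$ is \<open>w ! (j - 1)\<close>.\<close>

definition words :: "nat \<Rightarrow> nat \<Rightarrow> nat list set" where
  "words k n = {w. length w = n \<and> set w \<subseteq> {1..k}}"

definition repeat_at :: "'a list \<Rightarrow> nat \<Rightarrow> bool" where
  "repeat_at w j \<longleftrightarrow> 1 \<le> j \<and> j < length w \<and> w ! j = w ! (j - 1)"

definition no_repeat_equal_previous :: "'a list \<Rightarrow> bool" where
  "no_repeat_equal_previous w \<longleftrightarrow>
     (\<forall>j j'. j < j' \<and> repeat_at w j \<and> repeat_at w j' \<and> \<not> (\<exists>l. j < l \<and> l < j' \<and> repeat_at w l)
        \<longrightarrow> w ! j \<noteq> w ! j')"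

definition num_words :: "nat \<Rightarrow> nat \<Rightarrow> nat" where
  "num_words k n = card {w \<in> words k n. no_repeat_equal_previous w}"

definition word_gf :: "nat \<Rightarrow> rat fps" where
  "word_gf k = Abs_fps (\<lambda>n. of_nat (num_words k n))"

end

theory Submission
  imports Defs
begin

text \<open>Build words from right to left and remember the first repeated letter. A nonempty
  admissible word is in one of three states: no repetition yet, first repeated letter equal to the
  first letter, or first repeated letter different from the first letter. The number of letters
  which may be prepended, and the resulting state, depend only on the state, so that the three
  generating functions satisfy a linear system.\<close>

section \<open>First repeated letter of a word, and prepending a letter\<close>

fun first_rep :: "'a list \<Rightarrow> 'a option" where
  "first_rep (a # b # w) = (if a = b then Some a else first_rep (b # w))"
| "first_rep _ = None"

lemma repeat_at_Cons_Suc: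
  "repeat_at (a # w) (Suc j) \<longleftrightarrow> (if j = 0 then w \<noteq> [] \<and> a = hd w else repeat_at w j)"
  by (cases j; cases w) (auto simp: repeat_at_def)

lemma not_repeat_at_0 [simp]: "\<not> repeat_at w 0"
  by (simp add: repeat_at_def)

text \<open>Bridges the recursive description and the positional one in which admissibility is
  phrased. Equal leading letters make position 1 the least repetition; otherwise every repetition is
  one of the tail, shifted by one.\<close>

lemma first_rep_eq_Some_iff:
  "first_rep w = Some c \<longleftrightarrow> (\<exists>j. repeat_at w j \<and> w ! j = c \<and> (\<forall>l<j. \<not> repeat_at w l))"
proof (induction w rule: first_rep.induct)
  case (1 a b w)
  show ?case
  proof (cases "a = b")
    case True
    have rep: "repeat_at (a # b # w) (Suc 0)"
      using True by (simp add: repeat_at_Cons_Suc)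
    have "(repeat_at (a # b # w) j \<and> (\<forall>l<j. \<not> repeat_at (a # b # w) l)) \<longleftrightarrow> j = Suc 0" for j
      using rep by (metis less_Suc0 linorder_neqE_nat not_repeat_at_0)
    then have "(\<exists>j. repeat_at (a # b # w) j \<and> (a # b # w) ! j = c \<and>
        (\<forall>l<j. \<not> repeat_at (a # b # w) l)) \<longleftrightarrow> (a # b # w) ! Suc 0 = c"
      by metis
    then show ?thesis using True by simp
  next
    case False
    have [simp]: "repeat_at (a # b # w) (Suc j) \<longleftrightarrow> repeat_at (b # w) j" for j
      using False by (auto simp: repeat_at_Cons_Suc)
    \<comment> \<open>Position 0 is never a repetition, so a witness on the left is a
      successor.\<close>
    have "(\<exists>j. repeat_at (a # b # w) j \<and> (a # b # w) ! j = c \<and>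
          (\<forall>l<j. \<not> repeat_at (a # b # w) l)) \<longleftrightarrow>
        (\<exists>j. repeat_at (a # b # w) (Suc j) \<and> (a # b # w) ! Suc j = c \<and>
          (\<forall>l<Suc j. \<not> repeat_at (a # b # w) l))"
      (is "(\<exists>j. ?P j) \<longleftrightarrow> (\<exists>j. ?P (Suc j))")
    proof
      assume "\<exists>j. ?P j"
      then obtain j where j: "?P j" by blast
      moreover from j obtain i where "j = Suc i" by (cases j) auto
      ultimately show "\<exists>j. ?P (Suc j)" by blast
    qed blast
    also have "\<dots> \<longleftrightarrow> (\<exists>j. repeat_at (b # w) j \<and> (b # w) ! j = c \<and>
          (\<forall>l<j. \<not> repeat_at (b # w) l))"
      by (simp add: All_less_Suc2)
    finally show ?thesis
      using False 1 by simp
  qed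
qed (auto simp: repeat_at_def)

text \<open>Prepending \<open>a\<close> creates at most one repetition, at position 1, and it
  precedes all others. Hence the only new pair of consecutive repetitions consists of it and the
  first repetition of \<open>b # w\<close>.\<close>

lemma no_repeat_equal_previous_Cons_Cons:
  "no_repeat_equal_previous (a # b # w) \<longleftrightarrow>
     no_repeat_equal_previous (b # w) \<and> (a = b \<longrightarrow> first_rep (b # w) \<noteq> Some b)"
    (is "?L \<longleftrightarrow> ?R1 \<and> ?R2")
proof -
  let ?v = "a # b # w"
  have Suc_rep: "repeat_at ?v (Suc j)" if "repeat_at (b # w) j" for j
    using that by (cases j) (auto simp: repeat_at_Cons_Suc)
  \<comment> \<open>The converse needs \<open>j > 0\<close>: position 1 of \<open>?v\<close> may be
    the new repetition, which does not come from the tail.\<close>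
  have rep_Suc: "repeat_at ?v (Suc j) \<longleftrightarrow> repeat_at (b # w) j" if "j > 0" for j
    using that by (auto simp: repeat_at_Cons_Suc)
  have pos: "j > 0" if "repeat_at u j" for u :: "'a list" and j
    using that by (simp add: repeat_at_def)
  show ?thesis
  proof (intro iffI conjI)
    assume L: ?L
    show ?R1
      unfolding no_repeat_equal_previous_def
    proof (intro allI impI)
      fix j j'
      assume *: "j < j' \<and> repeat_at (b # w) j \<and> repeat_at (b # w) j' \<and>
        \<not> (\<exists>l. j < l \<and> l < j' \<and> repeat_at (b # w) l)"
      have "\<not> (\<exists>l. Suc j < l \<and> l < Suc j' \<and> repeat_at ?v l)"
      proof
        assume "\<exists>l. Suc j < l \<and> l < Suc j' \<and> repeat_at ?v l"
        then obtain l where l: "Suc j < l" "l < Suc j'" "repeat_at ?v l" by blast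
        then obtain i where "l = Suc i" "i > 0" by (cases l) auto
        with l rep_Suc * show False by auto
      qed
      with * L Suc_rep have "?v ! Suc j \<noteq> ?v ! Suc j'"
        unfolding no_repeat_equal_previous_def by blast
      then show "(b # w) ! j \<noteq> (b # w) ! j'" by simp
    qed
    show ?R2
    proof (intro impI notI)
      assume "a = b" "first_rep (b # w) = Some b"
      then obtain j where j: "repeat_at (b # w) j" "(b # w) ! j = b"
        "\<forall>l<j. \<not> repeat_at (b # w) l"
        unfolding first_rep_eq_Some_iff by blast
      \<comment> \<open>Positions 1 and \<open>Suc j\<close> are consecutive repetitions of the same
        letter \<open>b\<close>, contradicting admissibility of \<open>?v\<close>.\<close>
      have "repeat_at ?v (Suc 0)"
        using \<open>a = b\<close> by (simp add: repeat_at_Cons_Suc)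
      moreover have "\<not> (\<exists>l. Suc 0 < l \<and> l < Suc j \<and> repeat_at ?v l)"
      proof
        assume "\<exists>l. Suc 0 < l \<and> l < Suc j \<and> repeat_at ?v l"
        then obtain l where l: "Suc 0 < l" "l < Suc j" "repeat_at ?v l" by blast
        then obtain i where "l = Suc i" "i > 0" by (cases l) auto
        with l rep_Suc j show False by auto
      qed
      ultimately have "?v ! Suc 0 \<noteq> ?v ! Suc j"
        using L Suc_rep[OF j(1)] pos[OF j(1)] unfolding no_repeat_equal_previous_def by blast
      with j show False by simp
    qed
  next
    assume R: "?R1 \<and> ?R2"
    show ?L
      unfolding no_repeat_equal_previous_def
    proof (intro allI impI)
      fix i i'
      assume *: "i < i' \<and> repeat_at ?v i \<and> repeat_at ?v i' \<and>
        \<not> (\<exists>l. i < l \<and> l < i' \<and> repeat_at ?v l)"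
      then obtain j j' where [simp]: "i = Suc j" "i' = Suc j'" and "j < j'"
        by (cases i; cases i') auto
      then have j': "repeat_at (b # w) j'" using * rep_Suc by auto
      have between: "\<not> (\<exists>l. j < l \<and> l < j' \<and> repeat_at (b # w) l)"
        using * Suc_rep by auto
      show "?v ! i \<noteq> ?v ! i'"
      \<comment> \<open>For \<open>j = 0\<close> the pair starts with the new repetition, so
        \<open>j'\<close> is the first repetition of \<open>b # w\<close>; otherwise both positions
        come from the tail.\<close>
      proof (cases "j = 0")
        case True
        with * have "a = b" by (simp add: repeat_at_Cons_Suc)
        moreover have "first_rep (b # w) = Some ((b # w) ! j')"
          unfolding first_rep_eq_Some_iff using j' between True pos by blast
        ultimately show ?thesis using R True by auto
      next
        case False
        then have "repeat_at (b # w) j" using * rep_Suc by auto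
        then have "(b # w) ! j \<noteq> (b # w) ! j'"
          using R j' between \<open>j < j'\<close> unfolding no_repeat_equal_previous_def by blast
        then show ?thesis by simp
      qed
    qed
  qed
qed

lemma no_repeat_equal_previous_short:
  "length w \<le> 1 \<Longrightarrow> no_repeat_equal_previous w"
  by (auto simp: no_repeat_equal_previous_def repeat_at_def)

section \<open>The three states of a nonempty admissible word\<close>

definition words_in_state :: "(nat list \<Rightarrow> bool) \<Rightarrow> nat \<Rightarrow> nat \<Rightarrow> nat list set" where
  "words_in_state P k n = {w \<in> words k n. w \<noteq> [] \<and> no_repeat_equal_previous w \<and> P w}"

abbreviation fresh :: "nat list \<Rightarrow> bool" where
  "fresh w \<equiv> first_rep w = None"

text \<open>Here prepending \<open>hd w\<close> is forbidden: it would repeat the letter that is the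
  next one to be repeated.\<close>

abbreviation blocked :: "nat list \<Rightarrow> bool" where
  "blocked w \<equiv> first_rep w = Some (hd w)"

abbreviation unblocked :: "nat list \<Rightarrow> bool" where
  "unblocked w \<equiv> \<exists>c. first_rep w = Some c \<and> c \<noteq> hd w"

lemma finite_words: "finite (words k n)"
proof -
  have "words k n = {w. set w \<subseteq> {1..k} \<and> length w = n}" by (auto simp: words_def)
  then show ?thesis by (simp add: finite_lists_length_eq)
qed

lemma finite_words_in_state [simp]: "finite (words_in_state P k n)"
  by (simp add: words_in_state_def finite_words)

lemma first_rep_in_set: "first_rep w = Some c \<Longrightarrow> c \<in> set w"
  by (induction w rule: first_rep.induct) (auto split: if_splits)

text \<open>Makes the later counts exact: removing the head or the first repeated letter from
  \<open>{1..k}\<close> really lowers the cardinality.\<close>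

lemma words_in_state_letters:
  assumes "w \<in> words_in_state P k n"
  shows "hd w \<in> {1..k}" "first_rep w = Some c \<Longrightarrow> c \<in> {1..k}"
  using assms first_rep_in_set[of w c] by (auto simp: words_in_state_def words_def dest: hd_in_set)

section \<open>Counting one-letter extensions\<close>

lemma card_Union_Cons:
  assumes "finite S" "\<And>v. finite (C v)"
  shows "card (\<Union>v\<in>S. (\<lambda>a. a # v) ` C v) = (\<Sum>v\<in>S. card (C v))"
proof -
  have "card (\<Union>v\<in>S. (\<lambda>a. a # v) ` C v) = (\<Sum>v\<in>S. card ((\<lambda>a. a # v) ` C v))"
    using assms by (intro card_UN_disjoint) auto
  also have "\<dots> = (\<Sum>v\<in>S. card (C v))"
    by (intro sum.cong refl card_image inj_onI) simp
  finally show ?thesis .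
qed

text \<open>The only letter that may not be prepended is the head of a blocked tail, by
  \<open>no_repeat_equal_previous_Cons_Cons\<close>.\<close>

lemma Cons_in_words_in_state_iff:
  assumes "v \<noteq> []"
  shows "a # v \<in> words_in_state P k (Suc n) \<longleftrightarrow>
    v \<in> words_in_state (\<lambda>_. True) k n \<and> a \<in> {1..k} \<and> (a = hd v \<longrightarrow> \<not> blocked v) \<and> P (a # v)"
  using assms
  by (cases v) (auto simp: words_in_state_def words_def no_repeat_equal_previous_Cons_Cons)

lemma first_rep_Cons:
  "v \<noteq> [] \<Longrightarrow> first_rep (a # v) = (if a = hd v then Some a else first_rep v)"
  by (cases v) auto

lemma words_in_state_cases:
  assumes "w \<in> words_in_state P k (Suc (Suc n))"
  obtains a v where "w = a # v" "v \<noteq> []"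
proof -
  from assms have "length w = Suc (Suc n)" by (simp add: words_in_state_def words_def)
  then show ?thesis using that by (auto simp: length_Suc_conv)
qed

text \<open>The empty word has to stay outside the states: all \<open>k\<close> of its extensions
  are fresh, while a nonempty fresh word has only \<open>k - 1\<close> fresh extensions.\<close>

lemma words_in_state_nonempty [simp]: "[] \<notin> words_in_state P k n"
  by (simp add: words_in_state_def)

lemma words_in_stateD:
  assumes "w \<in> words_in_state P k n"
  shows "P w"
  using assms by (auto simp: words_in_state_def)

text \<open>Each word arises from exactly one tail, which is nonempty because the length is at least
  2. The set \<open>C v\<close> of admissible new letters is a parameter so that each target state
  can supply an explicit description.\<close>

lemma card_words_in_state_step:
  assumes C: "\<And>v. v \<noteq> [] \<Longrightarrow>
    C v = {a \<in> {1..k}. (a = hd v \<longrightarrow> \<not> blocked v) \<and> P (a # v)}"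
  shows "card (words_in_state P k (Suc (Suc n))) =
    (\<Sum>v\<in>words_in_state (\<lambda>_. True) k (Suc n). card (C v))"
proof -
  let ?C = "\<lambda>v. {a \<in> {1..k}. (a = hd v \<longrightarrow> \<not> blocked v) \<and> P (a # v)}"
  have "words_in_state P k (Suc (Suc n)) =
      (\<Union>v\<in>words_in_state (\<lambda>_. True) k (Suc n). (\<lambda>a. a # v) ` ?C v)" (is "?A = ?B")
  proof (intro set_eqI iffI)
    fix w assume w: "w \<in> ?A"
    then obtain a v where "w = a # v" "v \<noteq> []" by (rule words_in_state_cases)
    with w show "w \<in> ?B" by (auto simp: Cons_in_words_in_state_iff)
  next
    fix w assume "w \<in> ?B"
    then obtain a v where v: "w = a # v" "v \<in> words_in_state (\<lambda>_. True) k (Suc n)" "a \<in> ?C v"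
      by blast
    moreover from v(2) have "v \<noteq> []" by auto
    ultimately show "w \<in> ?A" by (auto simp: Cons_in_words_in_state_iff)
  qed
  also have "card \<dots> = (\<Sum>v\<in>words_in_state (\<lambda>_. True) k (Suc n). card (?C v))"
    by (rule card_Union_Cons) auto
  also have "\<dots> = (\<Sum>v\<in>words_in_state (\<lambda>_. True) k (Suc n). card (C v))"
    by (intro sum.cong refl) (metis C words_in_state_nonempty)
  finally show ?thesis .
qed

text \<open>The states partition the nonempty admissible words. An arbitrary summand
  \<open>g\<close> lets this serve both the transitions and the total count.\<close>

lemma sum_words_by_state:
  "(\<Sum>v\<in>words_in_state (\<lambda>_. True) k n. g v) =
     (\<Sum>v\<in>words_in_state fresh k n. g v) + (\<Sum>v\<in>words_in_state blocked k n. g v)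
      + (\<Sum>v\<in>words_in_state unblocked k n. g v)"
proof -
  have "words_in_state (\<lambda>_. True) k n =
      words_in_state fresh k n \<union> words_in_state blocked k n \<union> words_in_state unblocked k n"
    by (auto simp: words_in_state_def) (metis option.exhaust)
  moreover have "words_in_state fresh k n \<inter> words_in_state blocked k n = {}"
      "(words_in_state fresh k n \<union> words_in_state blocked k n) \<inter> words_in_state unblocked k n = {}"
    by (auto simp: words_in_state_def)
  ultimately show ?thesis by (simp only: sum.union_disjoint finite_words_in_state finite_UnI)
qed

text \<open>If the number of extensions into \<open>P\<close> is constant on each state, then
  \<open>x\<close>, \<open>y\<close>, \<open>z\<close> form one row of a transfer matrix.\<close>

lemma card_state_step:
  assumes "\<And>v. v \<noteq> [] \<Longrightarrow>
      C v = {a \<in> {1..k}. (a = hd v \<longrightarrow> \<not> blocked v) \<and> P (a # v)}"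
    and "\<And>v. v \<in> words_in_state fresh k (Suc n) \<Longrightarrow> card (C v) = x"
    and "\<And>v. v \<in> words_in_state blocked k (Suc n) \<Longrightarrow> card (C v) = y"
    and "\<And>v. v \<in> words_in_state unblocked k (Suc n) \<Longrightarrow> card (C v) = z"
  shows "card (words_in_state P k (Suc (Suc n))) =
      x * card (words_in_state fresh k (Suc n)) + y * card (words_in_state blocked k (Suc n))
        + z * card (words_in_state unblocked k (Suc n))"
proof -
  have "card (words_in_state P k (Suc (Suc n))) =
      (\<Sum>v\<in>words_in_state (\<lambda>_. True) k (Suc n). card (C v))"
    by (rule card_words_in_state_step) (rule assms(1))
  also have "\<dots> = (\<Sum>v\<in>words_in_state fresh k (Suc n). x)
      + (\<Sum>v\<in>words_in_state blocked k (Suc n). y)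
      + (\<Sum>v\<in>words_in_state unblocked k (Suc n). z)"
    unfolding sum_words_by_state using assms(2-)
    by (intro arg_cong2[of _ _ _ _ "(+)"] sum.cong refl)
  finally show ?thesis by (simp add: mult.commute)
qed


section \<open>Transition counts and initial values\<close>

lemma card_fresh_step:
  "card (words_in_state fresh k (Suc (Suc n))) = (k - 1) * card (words_in_state fresh k (Suc n))"
proof -
  \<comment> \<open>A fresh word comes only from a fresh tail, by a letter different from its
    head.\<close>
  let ?C = "\<lambda>v. if fresh v then {1..k} - {hd v} else {}"
  have "card (words_in_state fresh k (Suc (Suc n))) =
      (k - 1) * card (words_in_state fresh k (Suc n)) + 0 * card (words_in_state blocked k (Suc n))
        + 0 * card (words_in_state unblocked k (Suc n))"
  proof (rule card_state_step[of ?C])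
    show "card (?C v) = k - 1" if "v \<in> words_in_state fresh k (Suc n)" for v
      using words_in_state_letters(1)[OF that] words_in_stateD[OF that]
      by simp
  qed (auto simp: first_rep_Cons dest: words_in_stateD)
  then show ?thesis by simp
qed

lemma card_blocked_step:
  "card (words_in_state blocked k (Suc (Suc n))) =
    card (words_in_state fresh k (Suc n)) + 2 * card (words_in_state unblocked k (Suc n))"
proof -
  \<comment> \<open>A fresh tail becomes blocked by repeating its head; an unblocked one by
    repeating its head or by prepending its first repeated letter. A blocked tail cannot stay
    blocked, since its head is forbidden. The intersection with \<open>{1..k}\<close> is there
    because \<open>card_state_step\<close> asks for the equation for all nonempty \<open>v\<close>,
    whatever their letters.\<close>
  let ?C = "\<lambda>v. {1..k} \<inter>
    (if fresh v then {hd v} else if blocked v then {} else {hd v, the (first_rep v)})"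
  have "card (words_in_state blocked k (Suc (Suc n))) =
      1 * card (words_in_state fresh k (Suc n)) + 0 * card (words_in_state blocked k (Suc n))
        + 2 * card (words_in_state unblocked k (Suc n))"
  proof (rule card_state_step[of ?C])
    show "card (?C v) = 1" if "v \<in> words_in_state fresh k (Suc n)" for v
      using words_in_state_letters(1)[OF that] words_in_stateD[OF that]
      by simp
    show "card (?C v) = 2" if v: "v \<in> words_in_state unblocked k (Suc n)" for v
    proof -
      obtain c where c: "first_rep v = Some c" "c \<noteq> hd v"
        using words_in_stateD[OF v] by auto
      then have "?C v = {hd v, c}"
        using words_in_state_letters[OF v] by auto
      with c show ?thesis by simp
    qed
  qed (auto simp: first_rep_Cons dest: words_in_stateD)
  then show ?thesis by simp
qed

lemma card_unblocked_step:
  "card (words_in_state unblocked k (Suc (Suc n))) =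
    (k - 1) * card (words_in_state blocked k (Suc n))
      + (k - 2) * card (words_in_state unblocked k (Suc n))"
proof -
  \<comment> \<open>The new letter must avoid the head and the first repeated letter. These coincide
    for a blocked tail and differ for an unblocked one, whence \<open>k - 1\<close> and
    \<open>k - 2\<close>.\<close>
  let ?C = "\<lambda>v. if fresh v then {} else {1..k} - {hd v, the (first_rep v)}"
  have "card (words_in_state unblocked k (Suc (Suc n))) =
      0 * card (words_in_state fresh k (Suc n)) + (k - 1) * card (words_in_state blocked k (Suc n))
        + (k - 2) * card (words_in_state unblocked k (Suc n))"
  proof (rule card_state_step[of ?C])
    show "card (?C v) = k - 1" if "v \<in> words_in_state blocked k (Suc n)" for v
      using words_in_state_letters(1)[OF that] words_in_stateD[OF that]
      by simp
    show "card (?C v) = k - 2" if v: "v \<in> words_in_state unblocked k (Suc n)" for v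
    proof -
      obtain c where c: "first_rep v = Some c" "c \<noteq> hd v"
        using words_in_stateD[OF v] by auto
      then have "?C v = {1..k} - {hd v, c}" "{hd v, c} \<subseteq> {1..k}"
        using words_in_state_letters[OF v] by auto
      with c show ?thesis by (simp add: card_Diff_subset)
    qed
  qed (auto simp: first_rep_Cons dest: words_in_stateD)
  then show ?thesis by simp
qed

lemma card_words_in_state_0: "card (words_in_state P k 0) = 0"
proof -
  have "words_in_state P k 0 = {}" by (auto simp: words_in_state_def words_def)
  then show ?thesis by simp
qed

lemma words_in_state_1:
  "words_in_state P k (Suc 0) = {w \<in> (\<lambda>a. [a]) ` {1..k}. P w}"
  by (auto simp: words_in_state_def words_def length_Suc_conv no_repeat_equal_previous_short)

lemma card_fresh_1: "card (words_in_state fresh k (Suc 0)) = k"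
proof -
  have "words_in_state fresh k (Suc 0) = (\<lambda>a. [a]) ` {1..k}"
    by (auto simp: words_in_state_1)
  then show ?thesis by (simp add: card_image inj_on_def)
qed

lemma card_nonfresh_1:
  "card (words_in_state blocked k (Suc 0)) = 0" "card (words_in_state unblocked k (Suc 0)) = 0"
  by (auto simp: words_in_state_1)

lemma num_words_0: "num_words k 0 = 1"
proof -
  have "{w \<in> words k 0. no_repeat_equal_previous w} = {[]}"
    by (auto simp: words_def no_repeat_equal_previous_short)
  then show ?thesis by (simp add: num_words_def)
qed

lemma num_words_Suc:
  "num_words k (Suc n) = card (words_in_state fresh k (Suc n))
    + card (words_in_state blocked k (Suc n)) + card (words_in_state unblocked k (Suc n))"
proof -
  have "{w \<in> words k (Suc n). no_repeat_equal_previous w} = words_in_state (\<lambda>_. True) k (Suc n)"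
    by (auto simp: words_in_state_def words_def)
  then show ?thesis
    using sum_words_by_state[of "\<lambda>_. 1::nat" k "Suc n"] by (simp add: num_words_def)
qed

section \<open>Generating functions of the states\<close>

definition state_gf :: "(nat list \<Rightarrow> bool) \<Rightarrow> nat \<Rightarrow> rat fps" where
  "state_gf P k = Abs_fps (\<lambda>n. of_nat (card (words_in_state P k n)))"

text \<open>The summand 1 is the empty word, which lies in no state.\<close>

lemma word_gf_eq_sum_state_gf:
  "word_gf k = 1 + state_gf fresh k + state_gf blocked k + state_gf unblocked k"
proof (rule fps_ext)
  fix n
  show "fps_nth (word_gf k) n =
      fps_nth (1 + state_gf fresh k + state_gf blocked k + state_gf unblocked k) n"
    by (cases n)
      (simp_all add: word_gf_def state_gf_def num_words_0 num_words_Suc card_words_in_state_0)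
qed

text \<open>The factor \<open>fps_X\<close> encodes the added letter; the inhomogeneous term counts
  the one-letter words, all of them fresh. The bound on \<open>k\<close> turns truncated subtraction
  into subtraction of series.\<close>

lemma state_gf_fresh:
  assumes "k \<ge> 1"
  shows "state_gf fresh k =
    of_nat k * fps_X + (of_nat k - 1) * fps_X * state_gf fresh k"
proof -
  have "state_gf fresh k =
      fps_X * (fps_const (of_nat k) + fps_const (of_nat (k - 1)) * state_gf fresh k)"
  proof (rule fps_ext)
    fix n
    show "fps_nth (state_gf fresh k) n = fps_nth
        (fps_X * (fps_const (of_nat k) + fps_const (of_nat (k - 1)) * state_gf fresh k)) n"
    proof (cases n)
      \<comment> \<open>Length 1 is an initial value; the recurrence takes over from length
        2.\<close>
      case (Suc m)
      then show ?thesis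
        by (cases m) (simp_all add: state_gf_def card_fresh_step card_fresh_1 card_words_in_state_0)
    qed (simp add: state_gf_def card_words_in_state_0)
  qed
  moreover have "of_nat (k - 1) = (of_nat k - 1 :: rat fps)"
    using assms by (simp add: of_nat_diff)
  ultimately have "state_gf fresh k =
      fps_X * (of_nat k + (of_nat k - 1) * state_gf fresh k)"
    by (simp only: fps_of_nat)
  then show ?thesis by (simp add: algebra_simps)
qed

text \<open>There is no inhomogeneous term, because a one-letter word has no repetition.\<close>

lemma state_gf_blocked:
  "state_gf blocked k = fps_X * state_gf fresh k + 2 * fps_X * state_gf unblocked k"
proof -
  have "state_gf blocked k = fps_X * (state_gf fresh k + fps_const 2 * state_gf unblocked k)"
  proof (rule fps_ext)
    fix n
    show "fps_nth (state_gf blocked k) n =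
        fps_nth (fps_X * (state_gf fresh k + fps_const 2 * state_gf unblocked k)) n"
    proof (cases n)
      case (Suc m)
      then show ?thesis
        by (cases m)
          (simp_all add: state_gf_def card_blocked_step card_nonfresh_1 card_words_in_state_0)
    qed (simp add: state_gf_def card_words_in_state_0)
  qed
  then show ?thesis by (simp add: numeral_fps_const algebra_simps)
qed

lemma state_gf_unblocked:
  assumes "k \<ge> 2"
  shows "state_gf unblocked k = (of_nat k - 1) * fps_X * state_gf blocked k
    + (of_nat k - 2) * fps_X * state_gf unblocked k"
proof -
  have "state_gf unblocked k = fps_X * (fps_const (of_nat (k - 1)) * state_gf blocked k
      + fps_const (of_nat (k - 2)) * state_gf unblocked k)"
  proof (rule fps_ext)
    fix n
    show "fps_nth (state_gf unblocked k) n =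
        fps_nth (fps_X * (fps_const (of_nat (k - 1)) * state_gf blocked k
          + fps_const (of_nat (k - 2)) * state_gf unblocked k)) n"
    proof (cases n)
      case (Suc m)
      then show ?thesis
        by (cases m)
          (simp_all add: state_gf_def card_unblocked_step card_nonfresh_1 card_words_in_state_0)
    qed (simp add: state_gf_def card_words_in_state_0)
  qed
  moreover have "of_nat (k - 1) = (of_nat k - 1 :: rat fps)"
      "of_nat (k - 2) = (of_nat k - 2 :: rat fps)"
    using assms by (simp_all add: of_nat_diff)
  ultimately have "state_gf unblocked k =
      fps_X * ((of_nat k - 1) * state_gf blocked k + (of_nat k - 2) * state_gf unblocked k)"
    by (simp only: fps_of_nat)
  then show ?thesis by (simp add: algebra_simps)
qed

section \<open>Solving the linear system and deriving the closed form\<close>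

lemma solve_state_equations:
  fixes c x N E U W :: "'a :: comm_ring_1"
  assumes "N = c * x + (c - 1) * x * N"
    and "E = x * N + 2 * x * U"
    and "U = (c - 1) * x * E + (c - 2) * x * U"
    and "W = 1 + N + E + U"
  shows "- W * (2 * (c - 1) ^ 2 * x ^ 3 + (c - 1) * (c - 4) * x ^ 2 + (3 - 2 * c) * x + 1) =
    (c - 2) * x ^ 3 + 2 * (c - 2) * x ^ 2 + (c - 3) * x - 1"
proof -
  \<comment> \<open>\<open>p\<close> is the coefficient of \<open>N\<close> in its own equation, and
    \<open>q\<close> is the determinant of the system for \<open>E\<close> and \<open>U\<close>. A
    commutative ring offers no division, so these factors are carried along.\<close>
  define p where "p = 1 - (c - 1) * x"
  define q where "q = 1 - (c - 2) * x - 2 * (c - 1) * x ^ 2"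
  have N: "p * N = c * x"
    using assms(1) by (simp add: p_def algebra_simps)
  have U: "q * U = (c - 1) * x ^ 2 * N"
  proof -
    have "U - (c - 2) * x * U = (c - 1) * x * (x * N + 2 * x * U)"
      using assms(2,3) by (simp add: algebra_simps)
    then show ?thesis by (simp add: q_def algebra_simps power2_eq_square)
  qed
  have "q * E = x * (q * N + 2 * (q * U))"
    using assms(2) by (simp add: algebra_simps)
  \<comment> \<open>Substituting for \<open>q * U\<close> leaves the factor
    \<open>q + 2 * (c - 1) * x ^ 2\<close>, which is \<open>1 - (c - 2) * x\<close>.\<close>
  then have E: "q * E = x * (1 - (c - 2) * x) * N"
    unfolding U by (simp add: q_def algebra_simps power2_eq_square)
  \<comment> \<open>After multiplication by \<open>p * q\<close> each unknown can be reduced to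
    \<open>p * N\<close>, which is \<open>c * x\<close>.\<close>
  have "p * q * W = p * q + q * (p * N) + p * (q * E) + p * (q * U)"
    unfolding assms(4) by (simp add: algebra_simps)
  also have "\<dots> = p * q + q * (p * N) + x * (1 - (c - 2) * x) * (p * N)
      + (c - 1) * x ^ 2 * (p * N)"
    unfolding E U by (simp add: algebra_simps)
  finally have "p * q * W =
      p * q + (q + x * (1 - (c - 2) * x) + (c - 1) * x ^ 2) * (c * x)"
    unfolding N by (simp add: algebra_simps)
  \<comment> \<open>The denominator of the closed form factors as \<open>p * q\<close>.\<close>
  moreover have "2 * (c - 1) ^ 2 * x ^ 3 + (c - 1) * (c - 4) * x ^ 2 + (3 - 2 * c) * x + 1 = p * q"
    by (simp add: p_def q_def algebra_simps power2_eq_square power3_eq_cube)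
  moreover have "p * q + (q + x * (1 - (c - 2) * x) + (c - 1) * x ^ 2) * (c * x) =
      - ((c - 2) * x ^ 3 + 2 * (c - 2) * x ^ 2 + (c - 3) * x - 1)"
    by (simp add: p_def q_def algebra_simps power2_eq_square power3_eq_cube)
  ultimately show ?thesis
    by (simp only: mult.commute[of "- W"] mult_minus_right minus_minus)
qed

theorem theorem10:
  fixes k :: nat
  assumes "k \<ge> 2"
  shows "word_gf k =
    - (((of_nat k - 2) * fps_X ^ 3 + 2 * (of_nat k - 2) * fps_X ^ 2 + (of_nat k - 3) * fps_X - 1)
      / (2 * (of_nat k - 1) ^ 2 * fps_X ^ 3 + (of_nat k - 1) * (of_nat k - 4) * fps_X ^ 2
         + (3 - 2 * of_nat k) * fps_X + 1))"
proof -
  let ?num = "(of_nat k - 2) * fps_X ^ 3 + 2 * (of_nat k - 2) * fps_X ^ 2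
    + (of_nat k - 3) * fps_X - 1 :: rat fps"
  let ?den = "2 * (of_nat k - 1) ^ 2 * fps_X ^ 3 + (of_nat k - 1) * (of_nat k - 4) * fps_X ^ 2
    + (3 - 2 * of_nat k) * fps_X + 1 :: rat fps"
  have eq: "- word_gf k * ?den = ?num"
  proof (rule solve_state_equations)
    show "state_gf fresh k = of_nat k * fps_X + (of_nat k - 1) * fps_X * state_gf fresh k"
      using assms by (intro state_gf_fresh) simp
    show "state_gf blocked k = fps_X * state_gf fresh k + 2 * fps_X * state_gf unblocked k"
      by (rule state_gf_blocked)
    show "state_gf unblocked k = (of_nat k - 1) * fps_X * state_gf blocked k
        + (of_nat k - 2) * fps_X * state_gf unblocked k"
      using assms by (rule state_gf_unblocked)
  qed (rule word_gf_eq_sum_state_gf)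
  \<comment> \<open>The constant coefficient of \<open>?den\<close> is 1; being nonzero,
    \<open>?den\<close> can be cancelled from the product in \<open>eq\<close>.\<close>
  have nz: "?den \<noteq> 0"
  proof
    assume "?den = 0"
    then have "fps_nth ?den 0 = 0" by (simp only: fps_zero_nth)
    then show False by simp
  qed
  have "?num / ?den = - word_gf k"
    by (rule nonzero_mult_div_cancel_right[OF nz, of "- word_gf k", unfolded eq])
  then show ?thesis by (simp only: minus_minus)
qed

end
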